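(* Let $m,n,p\ge 1$, let $U\subset S^{(m)}$ and $X\subset S^{(n)}$ be non-empty, and let $\Phi:\mathbf{B}^n\times\mathbf{B}^m\to\mathbf{B}^n$ and $\Psi:\mathbf{B}^p\times\mathbf{B}^n\to\mathbf{B}^p$ be functions. Let $f:U\to P^*(S^{(n)})$ be a regular asynchronous system generated by $\Phi$, with initial state function $i_f:U\to P^*(\mathbf{B}^n)$ and computation function $\pi_f:\Delta_f\to P^*(P_n)$, i.e. for all $u\in U$, $f(u)=\{\Phi^\rho(\mu,u,\cdot)\mid \mu\in i_f(u),\ \rho\in\pi_f(\mu,u)\}$. Let $h:X\to P^*(S^{(p)})$ be a regular asynchronous system generated by $\Psi$, with initial state function $i_h:X\to P^*(\mathbf{B}^p)$ and computation function $\pi_h:\Delta_h\to P^*(P_p)$, i.e. for all $x\in X$, $h(x)=\{\Psi^{\widetilde\rho}(\delta,x,\cdot)\mid \delta\in i_h(x),\ \widetilde\rho\in\pi_h(\delta,x)\}$. Suppose $f(u)\subset X$ for all $u\in U$. Let $h*f$, $\Psi*\Phi$, $i$, $\pi$ and the orbits $(\Psi*\Phi)^{(\rho,\widetilde\rho)}((\mu,\delta),u,\cdot)$ be as defined in the context. Then for all $u\in U$, $$(h*f)(u)=\{(\Psi*\Phi)^{(\rho,\widetilde\rho)}((\mu,\delta),u,\cdot)\mid (\mu,\delta)\in i(u),\ (\rho,\widetilde\rho)\in\pi((\mu,\delta),u)\},$$ i.e. $h*f$ is regular, generated by $\Psi*\Phi$, with initial state function $i_{h*f}=i$ and computation fu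nction $\pi_{h*f}=\pi$.
   Context: $\mathbf{B}=\{0,1\}$ is the binary Boolean algebra with complement $\overline{\phantom{x}}$, product $\cdot$ and exclusive or $\oplus$ (applied coordinatewise on $\mathbf{B}^n$; a scalar in $\mathbf{B}$ multiplies a vector coordinatewise). $\chi_H:\mathbf{R}\to\mathbf{B}$ is the characteristic function of $H\subset\mathbf{R}$. $Seq$ is the set of strictly increasing real sequences $t_0<t_1<t_2<\dots$ unbounded from above. $P^*(H)$ is the set of non-empty subsets of $H$. $\mathbf{B}^{n+p}$ is identified with $\mathbf{B}^n\times\mathbf{B}^p$, and for functions $x:\mathbf{R}\to\mathbf{B}^n$, $y:\mathbf{R}\to\mathbf{B}^p$, $(x,y):\mathbf{R}\to\mathbf{B}^{n+p}$ is $(x,y)(t)=(x(t),y(t))$. Signals: $S^{(n)}$ is the set of $x:\mathbf{R}\to\mathbf{B}^n$ for which there are $\mu\in\mathbf{B}^n$ and $(t_k)\in Seq$ with $x(t)=\mu\cdot\chi_{(-\infty,t_0)}(t)\oplus x(t_0)\cdot\chi_{[t_0,t_1)}(t)\oplus\dots\oplus x(t_k)\cdot\chi_{[t_k,t_{k+1})}(t)\oplus\dots$ for all $t$. Progressive functions: $P_n$ is the set of $\rho:\mathbf{R}\to\mathbf{B}^n$ for which there is $(t_k)\in Seq$ with $\rho(t)=\rho(t_0)\cdot\chi_{\{t_0\}}(t)\oplus\dots\oplus\rho(t_k)\cdot\chi_{\{t_k\}}(t)\oplus\dots$ for all $t$ and such that for every $i\in\{1,\dots,n\}$ the set $\{k\in\mathbf{N}\mid\rho_i(t_k)=1\}$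 is infinite. For $\Phi:\mathbf{B}^n\times\mathbf{B}^m\to\mathbf{B}^n$ and $\nu\in\mathbf{B}^n$, $\Phi^\nu:\mathbf{B}^n\times\mathbf{B}^m\to\mathbf{B}^n$ is $\Phi^\nu(\mu,\lambda)=(\overline{\nu_1}\cdot\mu_1\oplus\nu_1\cdot\Phi_1(\mu,\lambda),\dots,\overline{\nu_n}\cdot\mu_n\oplus\nu_n\cdot\Phi_n(\mu,\lambda))$; similarly for $\Psi^{\widetilde\nu}$, $\widetilde\nu\in\mathbf{B}^p$. Orbits: let $\mu\in\mathbf{B}^n$, $u\in S^{(m)}$, $\rho\in P_n$; let $(t'_k)\in Seq$ be a sequence as in the definition of a signal for $u$ and $(t''_k)\in Seq$ a sequence as in the definition of a progressive function for $\rho$, and let $(t_k)\in Seq$ enumerate increasingly $\{t'_k\mid k\in\mathbf{N}\}\cup\{t''_k\mid k\in\mathbf{N}\}$. The orbit $\Phi^\rho(\mu,u,\cdot)\in S^{(n)}$ is $$\Phi^\rho(\mu,u,t)=\mu\cdot\chi_{(-\infty,t_0)}(t)\oplus\omega_0\cdot\chi_{[t_0,t_1)}(t)\oplus\dots\oplus\omega_k\cdot\chi_{[t_k,t_{k+1})}(t)\oplus\dots,$$ where $\omega_0=\Phi^{\rho(t_0)}(\mu,u(t_0))$ and $\omega_{k+1}=\Phi^{\rho(t_{k+1})}(\omega_k,u(t_{k+1}))$, $k\in\mathbf{N}$. Orbits of $\Psi$ (with inputs in $S^{(n)}$) are defined in the same way. A system is a function $f:U\to P^*(S^{(n)})$ with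 $U\in P^*(S^{(m)})$. It is regular, generated by $\Phi$, with initial state function $i_f:U\to P^*(\mathbf{B}^n)$ and computation function $\pi_f:\Delta_f\to P^*(P_n)$, $\Delta_f=\{(\mu,u)\mid u\in U,\mu\in i_f(u)\}$, if $f(u)=\{\Phi^\rho(\mu,u,\cdot)\mid\mu\in i_f(u),\rho\in\pi_f(\mu,u)\}$ for all $u\in U$. Likewise $\Delta_h=\{(\delta,x)\mid x\in X,\delta\in i_h(x)\}$. Serial connection: $h*f:U\to P^*(S^{(n+p)})$, $(h*f)(u)=\{(x,y)\mid x\in f(u),\ y\in h(x)\}$. For functions $\Phi:\mathbf{B}^n\times\mathbf{B}^m\to\mathbf{B}^n$ and $\Psi:\mathbf{B}^p\times\mathbf{B}^n\to\mathbf{B}^p$, $\Psi*\Phi:\mathbf{B}^{n+p}\times\mathbf{B}^m\to\mathbf{B}^{n+p}$ is $(\Psi*\Phi)((\mu,\delta),\lambda)=(\Phi(\mu,\lambda),\Psi(\delta,\Phi(\mu,\lambda)))$. For $\nu\in\mathbf{B}^n$, $\widetilde\nu\in\mathbf{B}^p$ one defines, for the serial connection, $(\Psi*\Phi)^{(\nu,\widetilde\nu)}=\Psi^{\widetilde\nu}*\Phi^\nu$, i.e. $(\Psi*\Phi)^{(\nu,\widetilde\nu)}((\mu,\delta),\lambda)=(\Phi^\nu(\mu,\lambda),\Psi^{\widetilde\nu}(\delta,\Phi^\nu(\mu,\lambda)))$. This definition (and not the coordinatewise formula used for $\Phi^\nu$) is the one used for $\Psi*\Phi$, both in forming the orbit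 $(\Psi*\Phi)^{(\rho,\widetilde\rho)}((\mu,\delta),u,\cdot)$ by the recursion above (with $(\rho,\widetilde\rho)\in P_{n+p}$ in the role of $\rho$ and $(\mu,\delta)$ in the role of $\mu$) and in the meaning of "generated by $\Psi*\Phi$". The functions $i:U\to P^*(\mathbf{B}^{n+p})$ and $\pi:\Delta\to P^*(P_{n+p})$ are $$i(u)=\{(\mu,\delta)\mid\mu\in i_f(u),\ \exists\rho'\in\pi_f(\mu,u),\ \delta\in i_h(\Phi^{\rho'}(\mu,u,\cdot))\},$$ $$\Delta=\{((\mu,\delta),u)\mid u\in U,\ \mu\in i_f(u),\ \exists\rho\in\pi_f(\mu,u),\ \delta\in i_h(\Phi^\rho(\mu,u,\cdot))\},$$ $$\pi((\mu,\delta),u)=\{(\rho,\widetilde\rho)\mid\rho\in\pi_f(\mu,u),\ \delta\in i_h(\Phi^\rho(\mu,u,\cdot)),\ \widetilde\rho\in\pi_h(\delta,\Phi^\rho(\mu,u,\cdot))\}.$$ *)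

theory Defs
  imports
    "HOL-Analysis.Finite_Cartesian_Product"
    "HOL-Library.Z2"
    "HOL-Library.Indicator_Function"
    "HOL-Library.Groups_Big_Fun"
    "HOL-Library.FuncSet"
begin

text \<open>
  The Boolean algebra \<open>B = {0, 1}\<close> is \<^typ>\<open>bit\<close>: exclusive or is addition, the product is
  multiplication and the complement is negation of bits. \<open>B\<^sup>n\<close> is \<^typ>\<open>bit ^ 'n\<close>
  with \<open>n = CARD('n)\<close> (so \<open>n \<ge> 1\<close>), and \<open>B\<^sup>n\<^sup>+\<^sup>p\<close> is \<^typ>\<open>bit ^ ('n + 'p)\<close>, identified with
  \<open>B\<^sup>n \<times> B\<^sup>p\<close> by \<open>join\<close> below. The characteristic function is \<^const>\<open>indicator\<close>.
\<close>

definition join :: "bit ^ 'n \<Rightarrow> bit ^ 'p \<Rightarrow> bit ^ ('n + 'p)" where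
  "join a b = (\<chi> i. case i of Inl j \<Rightarrow> a $ j | Inr j \<Rightarrow> b $ j)"

definition part1 :: "bit ^ ('n + 'p::finite) \<Rightarrow> bit ^ 'n" where
  "part1 w = (\<chi> j. w $ Inl j)"

definition part2 :: "bit ^ ('n::finite + 'p) \<Rightarrow> bit ^ 'p" where
  "part2 w = (\<chi> j. w $ Inr j)"

definition join_fun ::
  "(real \<Rightarrow> bit ^ 'n) \<Rightarrow> (real \<Rightarrow> bit ^ 'p) \<Rightarrow> real \<Rightarrow> bit ^ ('n + 'p)" where
  "join_fun x y = (\<lambda>t. join (x t) (y t))"

definition Pstar :: "'a set \<Rightarrow> 'a set set" where
  "Pstar H = {A. A \<subseteq> H \<and> A \<noteq> {}}"

definition Seq :: "(nat \<Rightarrow> real) set" where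
  "Seq = {t. strict_mono t \<and> \<not> bdd_above (range t)}"

text \<open>
  In the series below at most one term is nonzero at each time, so the sum over the finite
  support, \<^const>\<open>Sum_any\<close>, is the intended exclusive or of all terms.
\<close>

definition signal_seq :: "(nat \<Rightarrow> real) \<Rightarrow> (real \<Rightarrow> bit ^ 'n) \<Rightarrow> bool" where
  "signal_seq t x \<longleftrightarrow> t \<in> Seq \<and>
     (\<exists>\<mu>. \<forall>s. x s = indicator {..<t 0} s *s \<mu>
                  + Sum_any (\<lambda>k. indicator {t k..<t (Suc k)} s *s x (t k)))"

definition Signals :: "(real \<Rightarrow> bit ^ 'n) set" where
  "Signals = {x. \<exists>t. signal_seq t x}"

definition progressive_seq :: "(nat \<Rightarrow> real) \<Rightarrow> (real \<Rightarrow> bit ^ 'n) \<Rightarrow> bool" where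
  "progressive_seq t \<rho> \<longleftrightarrow> t \<in> Seq \<and>
     (\<forall>s. \<rho> s = Sum_any (\<lambda>k. indicator {t k} s *s \<rho> (t k))) \<and>
     (\<forall>i. infinite {k. \<rho> (t k) $ i = 1})"

definition Progressive :: "(real \<Rightarrow> bit ^ 'n) set" where
  "Progressive = {\<rho>. \<exists>t. progressive_seq t \<rho>}"

definition update ::
  "((bit ^ 'n) \<times> (bit ^ 'm) \<Rightarrow> bit ^ 'n) \<Rightarrow> bit ^ 'n \<Rightarrow> (bit ^ 'n) \<times> (bit ^ 'm) \<Rightarrow> bit ^ 'n" where
  "update \<Phi> \<nu> = (\<lambda>(\<mu>, l).
     \<chi> i. Bit_Operations.not (\<nu> $ i) * \<mu> $ i + \<nu> $ i * \<Phi> (\<mu>, l) $ i)"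

text \<open>
  Orbits are defined for an arbitrary family \<open>F\<close> in the role of \<open>\<nu> \<mapsto> \<Phi>\<^sup>\<nu>\<close>, because for the
  serial connection the family is not given by \<open>update\<close>.
\<close>

primrec orbit_state ::
  "(bit ^ 'n \<Rightarrow> (bit ^ 'n) \<times> (bit ^ 'm) \<Rightarrow> bit ^ 'n) \<Rightarrow> (nat \<Rightarrow> real) \<Rightarrow>
   (real \<Rightarrow> bit ^ 'n) \<Rightarrow> bit ^ 'n \<Rightarrow> (real \<Rightarrow> bit ^ 'm) \<Rightarrow> nat \<Rightarrow> bit ^ 'n" where
  "orbit_state F t \<rho> \<mu> u 0 = F (\<rho> (t 0)) (\<mu>, u (t 0))"
| "orbit_state F t \<rho> \<mu> u (Suc k) =
     F (\<rho> (t (Suc k))) (orbit_state F t \<rho> \<mu> u k, u (t (Suc k)))"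

definition orbit_along ::
  "(bit ^ 'n \<Rightarrow> (bit ^ 'n) \<times> (bit ^ 'm) \<Rightarrow> bit ^ 'n) \<Rightarrow> (nat \<Rightarrow> real) \<Rightarrow>
   (real \<Rightarrow> bit ^ 'n) \<Rightarrow> bit ^ 'n \<Rightarrow> (real \<Rightarrow> bit ^ 'm) \<Rightarrow> real \<Rightarrow> bit ^ 'n" where
  "orbit_along F t \<rho> \<mu> u = (\<lambda>s. indicator {..<t 0} s *s \<mu>
     + Sum_any (\<lambda>k. indicator {t k..<t (Suc k)} s *s orbit_state F t \<rho> \<mu> u k))"

text \<open>
  For \<open>u\<close> in \<^const>\<open>Signals\<close> and \<open>\<rho>\<close> in \<^const>\<open>Progressive\<close>, and for the families \<open>F\<close> used here
  (where \<open>F 0\<close> does not change the state), the function described does not depend on the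
  choice of the two sequences, so the description is a definite one.
\<close>

definition orbit ::
  "(bit ^ 'n \<Rightarrow> (bit ^ 'n) \<times> (bit ^ 'm) \<Rightarrow> bit ^ 'n) \<Rightarrow>
   (real \<Rightarrow> bit ^ 'n) \<Rightarrow> bit ^ 'n \<Rightarrow> (real \<Rightarrow> bit ^ 'm) \<Rightarrow> real \<Rightarrow> bit ^ 'n" where
  "orbit F \<rho> \<mu> u = (THE x. \<exists>t' t'' t. signal_seq t' u \<and> progressive_seq t'' \<rho> \<and>
     t \<in> Seq \<and> range t = range t' \<union> range t'' \<and> x = orbit_along F t \<rho> \<mu> u)"

definition is_system ::
  "(real \<Rightarrow> bit ^ 'm) set \<Rightarrow> ((real \<Rightarrow> bit ^ 'm) \<Rightarrow> (real \<Rightarrow> bit ^ 'n) set) \<Rightarrow> bool" where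
  "is_system U f \<longleftrightarrow> U \<in> Pstar Signals \<and> f \<in> U \<rightarrow> Pstar Signals"

definition Delta ::
  "(real \<Rightarrow> bit ^ 'm) set \<Rightarrow> ((real \<Rightarrow> bit ^ 'm) \<Rightarrow> (bit ^ 'n) set) \<Rightarrow>
   ((bit ^ 'n) \<times> (real \<Rightarrow> bit ^ 'm)) set" where
  "Delta U i = {(\<mu>, u). u \<in> U \<and> \<mu> \<in> i u}"

text \<open>The system \<open>f\<close> on \<open>U\<close> is regular, generated by the function with update family \<open>F\<close>,
  with initial state function \<open>i\<close> and computation function \<open>\<pi>\<close>.\<close>

definition regular_system ::
  "(bit ^ 'n \<Rightarrow> (bit ^ 'n) \<times> (bit ^ 'm) \<Rightarrow> bit ^ 'n) \<Rightarrow> (real \<Rightarrow> bit ^ 'm) set \<Rightarrow>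
   ((real \<Rightarrow> bit ^ 'm) \<Rightarrow> (real \<Rightarrow> bit ^ 'n) set) \<Rightarrow>
   ((real \<Rightarrow> bit ^ 'm) \<Rightarrow> (bit ^ 'n) set) \<Rightarrow>
   ((bit ^ 'n) \<times> (real \<Rightarrow> bit ^ 'm) \<Rightarrow> (real \<Rightarrow> bit ^ 'n) set) \<Rightarrow> bool" where
  "regular_system F U f i \<pi> \<longleftrightarrow>
     is_system U f \<and> i \<in> U \<rightarrow> Pstar UNIV \<and> \<pi> \<in> Delta U i \<rightarrow> Pstar Progressive \<and>
     (\<forall>u\<in>U. f u = {orbit F \<rho> \<mu> u | \<mu> \<rho>. \<mu> \<in> i u \<and> \<rho> \<in> \<pi> (\<mu>, u)})"

definition serial ::
  "((real \<Rightarrow> bit ^ 'n) \<Rightarrow> (real \<Rightarrow> bit ^ 'p) set) \<Rightarrow>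
   ((real \<Rightarrow> bit ^ 'm) \<Rightarrow> (real \<Rightarrow> bit ^ 'n) set) \<Rightarrow>
   (real \<Rightarrow> bit ^ 'm) \<Rightarrow> (real \<Rightarrow> bit ^ ('n + 'p)) set" where
  "serial h f u = {join_fun x y | x y. x \<in> f u \<and> y \<in> h x}"

definition serial_map ::
  "((bit ^ 'p) \<times> (bit ^ 'n) \<Rightarrow> bit ^ 'p) \<Rightarrow> ((bit ^ 'n) \<times> (bit ^ 'm) \<Rightarrow> bit ^ 'n) \<Rightarrow>
   (bit ^ ('n + 'p)) \<times> (bit ^ 'm) \<Rightarrow> bit ^ ('n + 'p)" where
  "serial_map \<Psi> \<Phi> = (\<lambda>(w, l).
     join (\<Phi> (part1 w, l)) (\<Psi> (part2 w, \<Phi> (part1 w, l))))"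

text \<open>
  The family \<open>(\<Psi> * \<Phi>)\<^sup>w\<close>; it differs from \<open>update (serial_map \<Psi> \<Phi>)\<close>, since the second
  component is fed with the updated, not the fully computed, first component.
\<close>

definition serial_update ::
  "((bit ^ 'p) \<times> (bit ^ 'n) \<Rightarrow> bit ^ 'p) \<Rightarrow> ((bit ^ 'n) \<times> (bit ^ 'm) \<Rightarrow> bit ^ 'n) \<Rightarrow>
   bit ^ ('n + 'p) \<Rightarrow> (bit ^ ('n + 'p)) \<times> (bit ^ 'm) \<Rightarrow> bit ^ ('n + 'p)" where
  "serial_update \<Psi> \<Phi> w = serial_map (update \<Psi> (part2 w)) (update \<Phi> (part1 w))"

definition serial_init ::
  "((bit ^ 'n) \<times> (bit ^ 'm) \<Rightarrow> bit ^ 'n) \<Rightarrow>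
   ((real \<Rightarrow> bit ^ 'm) \<Rightarrow> (bit ^ 'n) set) \<Rightarrow>
   ((bit ^ 'n) \<times> (real \<Rightarrow> bit ^ 'm) \<Rightarrow> (real \<Rightarrow> bit ^ 'n) set) \<Rightarrow>
   ((real \<Rightarrow> bit ^ 'n) \<Rightarrow> (bit ^ 'p) set) \<Rightarrow>
   (real \<Rightarrow> bit ^ 'm) \<Rightarrow> (bit ^ ('n + 'p)) set" where
  "serial_init \<Phi> i\<^sub>f \<pi>\<^sub>f i\<^sub>h u = {join \<mu> \<delta> | \<mu> \<delta>. \<mu> \<in> i\<^sub>f u \<and>
     (\<exists>\<rho>\<in>\<pi>\<^sub>f (\<mu>, u). \<delta> \<in> i\<^sub>h (orbit (update \<Phi>) \<rho> \<mu> u))}"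

definition serial_Delta ::
  "((bit ^ 'n) \<times> (bit ^ 'm) \<Rightarrow> bit ^ 'n) \<Rightarrow> (real \<Rightarrow> bit ^ 'm) set \<Rightarrow>
   ((real \<Rightarrow> bit ^ 'm) \<Rightarrow> (bit ^ 'n) set) \<Rightarrow>
   ((bit ^ 'n) \<times> (real \<Rightarrow> bit ^ 'm) \<Rightarrow> (real \<Rightarrow> bit ^ 'n) set) \<Rightarrow>
   ((real \<Rightarrow> bit ^ 'n) \<Rightarrow> (bit ^ 'p) set) \<Rightarrow>
   ((bit ^ ('n + 'p)) \<times> (real \<Rightarrow> bit ^ 'm)) set" where
  "serial_Delta \<Phi> U i\<^sub>f \<pi>\<^sub>f i\<^sub>h = {(join \<mu> \<delta>, u) | \<mu> \<delta> u. u \<in> U \<and> \<mu> \<in> i\<^sub>f u \<and>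
     (\<exists>\<rho>\<in>\<pi>\<^sub>f (\<mu>, u). \<delta> \<in> i\<^sub>h (orbit (update \<Phi>) \<rho> \<mu> u))}"

definition serial_comp ::
  "((bit ^ 'n) \<times> (bit ^ 'm) \<Rightarrow> bit ^ 'n) \<Rightarrow>
   ((bit ^ 'n) \<times> (real \<Rightarrow> bit ^ 'm) \<Rightarrow> (real \<Rightarrow> bit ^ 'n) set) \<Rightarrow>
   ((real \<Rightarrow> bit ^ 'n) \<Rightarrow> (bit ^ 'p) set) \<Rightarrow>
   ((bit ^ 'p) \<times> (real \<Rightarrow> bit ^ 'n) \<Rightarrow> (real \<Rightarrow> bit ^ 'p) set) \<Rightarrow>
   (bit ^ ('n + 'p)) \<times> (real \<Rightarrow> bit ^ 'm) \<Rightarrow> (real \<Rightarrow> bit ^ ('n + 'p)) set" where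
  "serial_comp \<Phi> \<pi>\<^sub>f i\<^sub>h \<pi>\<^sub>h = (\<lambda>(w, u).
     {join_fun \<rho> \<rho>' | \<rho> \<rho>'. \<rho> \<in> \<pi>\<^sub>f (part1 w, u) \<and>
        part2 w \<in> i\<^sub>h (orbit (update \<Phi>) \<rho> (part1 w) u) \<and>
        \<rho>' \<in> \<pi>\<^sub>h (part2 w, orbit (update \<Phi>) \<rho> (part1 w) u)})"

end

theory Submission
  imports Defs
begin

(* Because the update families leave the state unchanged when the update vector is 0, the state
   of an orbit at time s is obtained by applying, in increasing order, the updates at the finitely
   many times up to s at which the progressive function does not vanish. Hence any sequence covering
   the support of the progressive function computes the orbit, whatever the input is. Taking one
   sequence that covers the supports of both progressive functions, the serial recursion splits
   step by step into the recursions of the two systems, since the value of the first orbit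
   at a time of the sequence is its state after the update at that time. *)

section \<open>Joined vectors and neutral updates\<close>

lemma part1_join [simp]: "part1 (join a b) = a"
  by (simp add: part1_def join_def vec_eq_iff)

lemma part2_join [simp]: "part2 (join a b) = b"
  by (simp add: part2_def join_def vec_eq_iff)

lemma join_part1_part2 [simp]: "join (part1 w) (part2 w) = w"
  by (auto simp: part1_def part2_def join_def vec_eq_iff split: sum.split)

lemma join_eq_iff [simp]: "join a b = join a' b' \<longleftrightarrow> a = a' \<and> b = b'"
  by (metis part1_join part2_join)

lemma join_nth [simp]: "join a b $ Inl i = a $ i" "join a b $ Inr j = b $ j"
  by (simp_all add: join_def)

lemma join_0_0 [simp]: "join 0 0 = 0"
  by (auto simp: join_def vec_eq_iff split: sum.split)

lemma join_fun_eq_iff [simp]: "join_fun x y = join_fun x' y' \<longleftrightarrow> x = x' \<and> y = y'"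
  by (auto simp: join_fun_def fun_eq_iff)

lemma part1_0 [simp]: "part1 0 = 0"
  by (simp add: part1_def vec_eq_iff)

lemma part2_0 [simp]: "part2 0 = 0"
  by (simp add: part2_def vec_eq_iff)

lemma update_0 [simp]: "update \<Phi> 0 (w, l) = w"
  by (simp add: update_def vec_eq_iff)

text \<open>An update with vector 0 ignores the value fed to it, so the second component stays put
  no matter what the first one passes on. Neutrality thus holds for this family although it is not
  coordinatewise.\<close>

lemma serial_update_0 [simp]: "serial_update \<Psi> \<Phi> 0 (w, l) = w"
  by (simp add: serial_update_def serial_map_def)

section \<open>Sequences of times: location, enumeration, refinement\<close>

lemma Seq_iff: "t \<in> Seq \<longleftrightarrow> strict_mono t \<and> (\<forall>s. \<exists>k. s < t k)"
  by (auto simp: Seq_def bdd_above_def not_le)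

text \<open>Unboundedness gives an index whose time lies beyond \<open>s\<close>; going down from
  it, the sequence must cross \<open>s\<close> unless \<open>s\<close> is before
  \<open>t 0\<close>.\<close>

lemma Seq_locate:
  assumes "t \<in> Seq"
  obtains "s < t 0" | k where "t k \<le> s" "s < t (Suc k)"
proof (cases "s < t 0")
  case False
  obtain n where "s < t n" using assms by (auto simp: Seq_iff)
  then have "\<exists>k. \<not> s < t k \<and> s < t (Suc k)"
    using False by (induction n) auto
  then show ?thesis using that(2) by (auto simp: not_less)
qed (use that in blast)

lemma Seq_locally_finite:
  assumes "t \<in> Seq"
  shows "finite (range t \<inter> {..s})"
proof -
  obtain n where "s < t n" using assms by (auto simp: Seq_iff)
  moreover have "strict_mono t" using assms by (simp add: Seq_iff)
  ultimately have "k < n" if "t k \<le> s" for k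
    using that by (metis strict_mono_less le_less_trans)
  then have "range t \<inter> {..s} \<subseteq> t ` {..<n}" by auto
  then show ?thesis using finite_subset by blast
qed

text \<open>Counting the elements of \<open>A\<close> below a given one is a strictly increasing map
  of \<open>A\<close> into the naturals. The increasing enumeration of its infinite image is pulled
  back to \<open>A\<close>. The result is unbounded because a bounded part of \<open>A\<close> is
  finite.\<close>

lemma Seq_enumeration:
  fixes A :: "real set"
  assumes "infinite A" and fin: "\<And>s. finite (A \<inter> {..s})"
  obtains t where "t \<in> Seq" "range t = A"
proof -
  define c where "c a = card (A \<inter> {..<a})" for a
  have c_less: "c a < c b" if "a \<in> A" "a < b" for a b
    unfolding c_def
  \<comment> \<open>The inclusion is strict because \<open>a\<close> itself is counted for
    \<open>b\<close> but not for \<open>a\<close>.\<close>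
  proof (rule psubset_card_mono)
    show "finite (A \<inter> {..<b})" by (rule finite_subset[OF _ fin[of b]]) auto
  qed (use that in auto)
  have inj: "inj_on c A"
    by (rule linorder_inj_onI') (use c_less in force)
  then have inf: "infinite (c ` A)" using \<open>infinite A\<close> by (simp add: finite_image_iff)
  define t where "t k = inv_into A c (enumerate (c ` A) k)" for k
  have mem: "enumerate (c ` A) k \<in> c ` A" for k using inf by (rule enumerate_in_set)
  then have tA: "t k \<in> A" and ct: "c (t k) = enumerate (c ` A) k" for k
    unfolding t_def by (auto intro: inv_into_into f_inv_into_f)
  have "strict_mono t"
  proof (rule strict_monoI)
    fix j k :: nat assume "j < k"
    then have "c (t j) < c (t k)" using inf by (simp add: ct enumerate_mono)
    then show "t j < t k" using c_less[OF tA, of k "t j"] by (cases "t j" "t k" rule: linorder_cases) auto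
  qed
  moreover have "range t = A"
  proof -
    have "a \<in> range t" if "a \<in> A" for a
    proof -
      have "c a \<in> range (enumerate (c ` A))"
        using inf that by (simp add: range_enumerate)
      then obtain k where "c (t k) = c a" by (auto simp: ct)
      then show ?thesis using inj_onD[OF inj _ tA that] by blast
    qed
    then show ?thesis using tA by auto
  qed
  moreover have "\<not> bdd_above A"
  proof
    assume "bdd_above A"
    then obtain s where "A \<subseteq> {..s}" by (auto simp: bdd_above_def)
    then show False using fin[of s] \<open>infinite A\<close> by (simp add: Int_absorb2)
  qed
  ultimately show ?thesis using that by (auto simp: Seq_def)
qed

lemma Seq_common_refinement:
  assumes "t \<in> Seq" "r \<in> Seq"
  obtains q where "q \<in> Seq" "range q = range t \<union> range r"
proof (rule Seq_enumeration)
  show "infinite (range t \<union> range r)"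
    using assms(1) by (auto simp: Seq_def strict_mono_imp_inj_on dest: range_inj_infinite)
  show "finite ((range t \<union> range r) \<inter> {..s})" for s
    using assms by (simp add: Int_Un_distrib2 Seq_locally_finite)
qed (use that in auto)

section \<open>Signals as step functions\<close>

lemma Sum_any_eq_single:
  assumes "\<And>j. j \<noteq> k \<Longrightarrow> g j = 0"
  shows "Sum_any g = g k"
proof -
  have "Sum_any g = sum g {k}"
    by (rule Sum_any.expand_superset) (use assms in auto)
  then show ?thesis by simp
qed

text \<open>The half-open pieces are pairwise disjoint, so only the one that contains
  \<open>s\<close> contributes.\<close>

lemma Sum_any_pieces:
  assumes "t \<in> Seq" "t k \<le> s" "s < t (Suc k)"
  shows "Sum_any (\<lambda>j. indicator {t j..<t (Suc j)} s *s g j) = (g k :: bit ^ 'n)"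
proof -
  have "s \<notin> {t j..<t (Suc j)}" if "j \<noteq> k" for j
  proof -
    have "mono t" using assms by (simp add: Seq_iff strict_mono_mono)
    then have "t (Suc j) \<le> t k \<or> t (Suc k) \<le> t j"
      using that by (metis Suc_leI linorder_neqE_nat monoD)
    then show ?thesis using assms by auto
  qed
  then show ?thesis by (subst Sum_any_eq_single[of k]) (use assms in auto)
qed

lemma Sum_any_pieces_before:
  assumes "t \<in> Seq" "s < t 0"
  shows "Sum_any (\<lambda>j. indicator {t j..<t (Suc j)} s *s g j) = (0 :: bit ^ 'n)"
proof -
  have "t 0 \<le> t j" for j using assms by (simp add: Seq_iff strict_mono_less_eq)
  then have "s \<notin> {t j..<t (Suc j)}" for j using assms by (metis atLeastLessThan_iff leD le_less_trans)
  then show ?thesis by simp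
qed

text \<open>The series says that \<open>x\<close> is constant before \<open>t 0\<close> and on each
  piece. Expressed through jumps, this depends on \<open>t\<close> only through its range and
  survives refinement of \<open>t\<close>. The interval \<open>{a<..b}\<close> is open at
  \<open>a\<close> since the pieces are closed on the left: a jump at \<open>a\<close> is already
  part of \<open>x a\<close>.\<close>

lemma signal_seq_iff:
  "signal_seq t x \<longleftrightarrow>
     t \<in> Seq \<and> (\<forall>a b. a \<le> b \<longrightarrow> range t \<inter> {a<..b} = {} \<longrightarrow> x a = x b)"
proof (cases "t \<in> Seq")
  case t: True
  show ?thesis
  proof
    assume "signal_seq t x"
    then obtain \<mu> where x: "x s = indicator {..<t 0} s *s \<mu>
        + Sum_any (\<lambda>k. indicator {t k..<t (Suc k)} s *s x (t k))" for s
      by (auto simp: signal_seq_def)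
    have before: "x s = \<mu>" if "s < t 0" for s
      by (subst x) (use that in \<open>simp add: Sum_any_pieces_before[OF t]\<close>)
    have piece: "x s = x (t k)" if "t k \<le> s" "s < t (Suc k)" for s k
    proof -
      have "t 0 \<le> t k" using t by (simp add: Seq_iff strict_mono_less_eq)
      then show ?thesis
        by (subst x) (use that in \<open>simp add: Sum_any_pieces[OF t that]\<close>)
    qed
    have "x a = x b" if ab: "a \<le> b" "range t \<inter> {a<..b} = {}" for a b
    proof -
      \<comment> \<open>No time of the sequence separates \<open>a\<close> from \<open>b\<close>, so
        both are before \<open>t 0\<close> or in the same piece.\<close>
      have *: "b < t k" if "a < t k" for k
        using ab that by (metis disjoint_iff greaterThanAtMost_iff not_le rangeI)
      show ?thesis
        using t
      proof (cases rule: Seq_locate[where s = a])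
        case 1
        then show ?thesis using before * by simp
      next
        case (2 k)
        then show ?thesis using piece[of k a] piece[of k b] * ab by simp
      qed
    qed
    then show "t \<in> Seq \<and> (\<forall>a b. a \<le> b \<longrightarrow> range t \<inter> {a<..b} = {} \<longrightarrow> x a = x b)"
      using t by blast
  next
    assume "t \<in> Seq \<and> (\<forall>a b. a \<le> b \<longrightarrow> range t \<inter> {a<..b} = {} \<longrightarrow> x a = x b)"
    then have const: "x a = x b" if "a \<le> b" "range t \<inter> {a<..b} = {}" for a b
      using that by blast
    have mono: "t j < t k \<longleftrightarrow> j < k" "t j \<le> t k \<longleftrightarrow> j \<le> k" for j k
      using t by (auto simp: Seq_iff strict_mono_less strict_mono_less_eq)
    \<comment> \<open>The initial value is read off at \<open>t 0 - 1\<close>, an arbitrary point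
      before \<open>t 0\<close>. As \<open>s\<close> may lie on either side of it,
      \<open>const\<close> is applied in both orders.\<close>
    have "x s = indicator {..<t 0} s *s x (t 0 - 1)
        + Sum_any (\<lambda>k. indicator {t k..<t (Suc k)} s *s x (t k))" for s
      using t
    proof (cases rule: Seq_locate[where s = s])
      case 1
      have "t k \<notin> {a<..b}" if "b < t 0" for a b k
        using that mono(2)[of 0 k] by auto
      then have "range t \<inter> {a<..b} = {}" if "b < t 0" for a b
        using that by blast
      then have "x s = x (t 0 - 1)"
        using 1 const[of s "t 0 - 1"] const[of "t 0 - 1" s]
        by (metis diff_less_eq less_add_one linear)
      then show ?thesis using 1 by (simp add: Sum_any_pieces_before[OF t])
    next
      case (2 k)
      have "t j \<notin> {t k<..s}" for j
        using 2 mono(1)[of k j] mono(2)[of "Suc k" j] by auto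
      then have "x (t k) = x s" using 2 by (intro const) auto
      moreover have "t 0 \<le> t k" by (simp add: mono)
      ultimately show ?thesis using 2 by (simp add: Sum_any_pieces[OF t 2])
    qed
    then show "signal_seq t x" using t unfolding signal_seq_def by blast
  qed
qed (simp add: signal_seq_def)

text \<open>On a common refinement, neither component jumps between consecutive times.\<close>

lemma join_fun_Signals:
  assumes "x \<in> Signals" "y \<in> Signals"
  shows "join_fun x y \<in> Signals"
proof -
  obtain t r where t: "signal_seq t x" and r: "signal_seq r y"
    using assms by (auto simp: Signals_def)
  then obtain q where q: "q \<in> Seq" "range q = range t \<union> range r"
    using Seq_common_refinement by (metis signal_seq_iff)
  have "signal_seq q (join_fun x y)"
    unfolding signal_seq_iff
  proof (intro conjI allI impI)
    fix a b :: real assume ab: "a \<le> b" "range q \<inter> {a<..b} = {}"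
    then have "range t \<inter> {a<..b} = {}" "range r \<inter> {a<..b} = {}" using q by auto
    then have "x a = x b" "y a = y b" using t r ab by (auto simp: signal_seq_iff)
    then show "join_fun x y a = join_fun x y b" by (simp add: join_fun_def)
  qed (rule q)
  then show ?thesis by (auto simp: Signals_def)
qed

section \<open>Progressive functions and their supports\<close>

lemma progressive_seq_iff:
  "progressive_seq t \<rho> \<longleftrightarrow>
     t \<in> Seq \<and> {s. \<rho> s \<noteq> 0} \<subseteq> range t \<and> (\<forall>i. infinite {s. \<rho> s $ i = 1})"
proof (cases "t \<in> Seq")
  case True
  then have inj: "inj t" by (simp add: Seq_iff strict_mono_imp_inj_on)
  \<comment> \<open>At most one index has \<open>t k = s\<close>, so the series equation only says
    that \<open>\<rho>\<close> vanishes off the range of \<open>t\<close>.\<close>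
  have at: "Sum_any (\<lambda>k. indicator {t k} s *s \<rho> (t k)) = (if s \<in> range t then \<rho> s else 0)" for s
  proof (cases "s \<in> range t")
    case True
    then obtain k where k: "s = t k" by blast
    have "Sum_any (\<lambda>k. indicator {t k} s *s \<rho> (t k)) = indicator {t k} s *s \<rho> (t k)"
      by (rule Sum_any_eq_single) (use inj k in \<open>auto simp: inj_eq\<close>)
    then show ?thesis using True k by simp
  next
    case False
    then have "indicator {t k} s *s \<rho> (t k) = 0" for k by (auto simp: indicator_def)
    then show ?thesis using False by (simp del: vector_mul_eq_0)
  qed
  have support: "(\<forall>s. \<rho> s = Sum_any (\<lambda>k. indicator {t k} s *s \<rho> (t k))) \<longleftrightarrow>
      {s. \<rho> s \<noteq> 0} \<subseteq> range t"
    unfolding at by (auto split: if_splits)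
  \<comment> \<open>Injectivity of \<open>t\<close> moves the count from indices to times, which
    makes the condition independent of \<open>t\<close>.\<close>
  have "infinite {k. \<rho> (t k) $ i = 1} \<longleftrightarrow> infinite {s. \<rho> s $ i = 1}"
    if "{s. \<rho> s \<noteq> 0} \<subseteq> range t" for i
  proof -
    have "\<rho> s \<noteq> 0" if "\<rho> s $ i = 1" for s using that by auto
    then have "{s. \<rho> s $ i = 1} = t ` {k. \<rho> (t k) $ i = 1}"
      using that by (auto simp: image_iff subset_iff)
    then show ?thesis using inj by (simp add: finite_image_iff inj_on_subset)
  qed
  then show ?thesis using True support unfolding progressive_seq_def by blast
qed (simp add: progressive_seq_def)

lemma ProgressiveE:
  assumes "\<rho> \<in> Progressive"
  obtains t where "t \<in> Seq" "{s. \<rho> s \<noteq> 0} \<subseteq> range t"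
  using assms by (auto simp: Progressive_def progressive_seq_iff)

text \<open>This provides the single sequence along which both orbits and the serial orbit are
  computed at once. A joined value is nonzero only if one of its parts is.\<close>

lemma Progressive_common_cover:
  assumes "\<rho> \<in> Progressive" "\<rho>' \<in> Progressive"
  obtains t where "t \<in> Seq" "{s. \<rho> s \<noteq> 0} \<subseteq> range t" "{s. \<rho>' s \<noteq> 0} \<subseteq> range t"
    "{s. join_fun \<rho> \<rho>' s \<noteq> 0} \<subseteq> range t"
proof -
  obtain q r where "q \<in> Seq" "{s. \<rho> s \<noteq> 0} \<subseteq> range q" "r \<in> Seq" "{s. \<rho>' s \<noteq> 0} \<subseteq> range r"
    using assms by (metis ProgressiveE)
  moreover from this obtain t where "t \<in> Seq" "range t = range q \<union> range r"
    using Seq_common_refinement by metis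
  moreover have "{s. join_fun \<rho> \<rho>' s \<noteq> 0} \<subseteq> {s. \<rho> s \<noteq> 0} \<union> {s. \<rho>' s \<noteq> 0}"
    by (auto simp: join_fun_def)
  ultimately show ?thesis by (intro that[of t]) blast+
qed

lemma join_fun_Progressive:
  assumes "\<rho> \<in> Progressive" "\<rho>' \<in> Progressive"
  shows "join_fun \<rho> \<rho>' \<in> Progressive"
proof -
  obtain t where t: "t \<in> Seq" "{s. join_fun \<rho> \<rho>' s \<noteq> 0} \<subseteq> range t"
    using Progressive_common_cover[OF assms] .
  have "infinite {s. join_fun \<rho> \<rho>' s $ i = 1}" for i
    using assms by (cases i) (auto simp: join_fun_def Progressive_def progressive_seq_iff)
  then show ?thesis using t by (auto simp: Progressive_def progressive_seq_iff)
qed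

section \<open>Orbits and their independence of the chosen sequence\<close>

lemma orbit_along_before:
  assumes "t \<in> Seq" "s < t 0"
  shows "orbit_along F t \<rho> \<mu> u s = \<mu>"
  using assms by (simp add: orbit_along_def Sum_any_pieces_before)

lemma orbit_along_piece:
  assumes "t \<in> Seq" "t k \<le> s" "s < t (Suc k)"
  shows "orbit_along F t \<rho> \<mu> u s = orbit_state F t \<rho> \<mu> u k"
proof -
  have "t 0 \<le> t k" using assms by (simp add: Seq_iff strict_mono_less_eq)
  then show ?thesis using assms by (simp add: orbit_along_def Sum_any_pieces)
qed

lemma orbit_along_at:
  assumes "t \<in> Seq"
  shows "orbit_along F t \<rho> \<mu> u (t k) = orbit_state F t \<rho> \<mu> u k"
  using assms by (intro orbit_along_piece) (auto simp: Seq_iff strict_mono_less)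

lemma foldl_filter_neutral:
  assumes "\<And>w a. \<not> P a \<Longrightarrow> g w a = w"
  shows "foldl g w (filter P xs) = foldl g w xs"
  using assms by (induction xs arbitrary: w) auto

text \<open>As a fold, the state allows neutral times to be dropped from the list. The state of
  index 0 already contains the update at \<open>t 0\<close>, hence the bound
  \<open>Suc k\<close>.\<close>

lemma orbit_state_eq_foldl:
  "orbit_state F t \<rho> \<mu> u k =
     foldl (\<lambda>w \<tau>. F (\<rho> \<tau>) (w, u \<tau>)) \<mu> (map t [0..<Suc k])"
  by (induction k) auto

text \<open>Dropping the neutral times from the fold leaves the support of \<open>\<rho>\<close> up
  to \<open>s\<close> in increasing order. The right-hand side is free of \<open>t\<close>, which is
  the source of all independence claims.\<close>

lemma orbit_along_eq_foldl:
  assumes t: "t \<in> Seq" and supp: "{s. \<rho> s \<noteq> 0} \<subseteq> range t"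
    and neutral: "\<And>w l. F 0 (w, l) = w"
  shows "orbit_along F t \<rho> \<mu> u s =
    foldl (\<lambda>w \<tau>. F (\<rho> \<tau>) (w, u \<tau>)) \<mu> (sorted_list_of_set {\<tau>. \<tau> \<le> s \<and> \<rho> \<tau> \<noteq> 0})"
  using t
proof (cases rule: Seq_locate[where s = s])
  case 1
  moreover have "t 0 \<le> t k" for k using t by (simp add: Seq_iff strict_mono_less_eq)
  ultimately have "t k \<notin> {..s}" for k by (metis atMost_iff leD le_less_trans)
  \<comment> \<open>All support times are at or after \<open>t 0\<close>, so the fold is empty and
    both sides are \<open>\<mu>\<close>.\<close>
  then have "{\<tau>. \<tau> \<le> s \<and> \<rho> \<tau> \<noteq> 0} = {}" using supp by fastforce
  then show ?thesis using 1 t by (simp only: orbit_along_before) simp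
next
  case (2 k)
  have mono: "strict_mono t" using t by (simp add: Seq_iff)
  let ?ts = "filter (\<lambda>\<tau>. \<rho> \<tau> \<noteq> 0) (map t [0..<Suc k])"
  have "t j \<le> s \<longleftrightarrow> j \<le> k" for j
  proof
    show "j \<le> k" if "t j \<le> s"
    proof -
      have "t j < t (Suc k)" using that 2 by simp
      then show ?thesis using mono by (simp add: strict_mono_less)
    qed
    show "t j \<le> s" if "j \<le> k"
      using that 2 mono by (metis order_trans strict_mono_less_eq)
  qed
  then have "t ` {..k} = {\<tau> \<in> range t. \<tau> \<le> s}" by blast
  moreover have "set ?ts = {\<tau> \<in> t ` {..k}. \<rho> \<tau> \<noteq> 0}"
    by (simp add: atLeast0LessThan lessThan_Suc_atMost del: upt_Suc)
  \<comment> \<open>Since \<open>t\<close> covers the support, \<open>?ts\<close> keeps every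
    support time up to \<open>s\<close>, and \<open>t\<close> drops out of the description.\<close>
  ultimately have "set ?ts = {\<tau>. \<tau> \<le> s \<and> \<rho> \<tau> \<noteq> 0}" using supp by blast
  moreover have "sorted_wrt (<) ?ts"
    using mono by (intro sorted_wrt_filter)
      (simp add: sorted_wrt_map strict_mono_less del: upt_Suc)
  ultimately have "sorted_list_of_set {\<tau>. \<tau> \<le> s \<and> \<rho> \<tau> \<noteq> 0} = ?ts"
    using sorted_list_of_set.idem_if_sorted_distinct[of ?ts] by (simp only: strict_sorted_iff)
  moreover have "orbit_along F t \<rho> \<mu> u s = foldl (\<lambda>w \<tau>. F (\<rho> \<tau>) (w, u \<tau>)) \<mu> ?ts"
    by (subst foldl_filter_neutral)
      (auto simp: neutral orbit_along_piece[OF t 2] orbit_state_eq_foldl simp del: upt_Suc)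
  ultimately show ?thesis by simp
qed

text \<open>The description in \<open>orbit\<close> is satisfied, by refining sequences for
  \<open>u\<close> and \<open>\<rho>\<close>, and it is definite because every admissible sequence
  covers the support of \<open>\<rho>\<close> and so yields the same fold. The sequence
  \<open>t\<close> is tied to \<open>\<rho>\<close> alone, hence one \<open>t\<close> can serve
  orbits with different inputs.\<close>

lemma orbit_eq_orbit_along:
  assumes u: "u \<in> Signals" and \<rho>: "\<rho> \<in> Progressive"
    and t: "t \<in> Seq" "{s. \<rho> s \<noteq> 0} \<subseteq> range t"
    and neutral: "\<And>w l. F 0 (w, l) = w"
  shows "orbit F \<rho> \<mu> u = orbit_along F t \<rho> \<mu> u"
  unfolding orbit_def
proof (rule the_equality)
  have indep: "orbit_along F q \<rho> \<mu> u = orbit_along F t \<rho> \<mu> u"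
    if "q \<in> Seq" "{s. \<rho> s \<noteq> 0} \<subseteq> range q" for q
    using that t neutral by (simp add: fun_eq_iff orbit_along_eq_foldl)
  obtain t' t'' where *: "signal_seq t' u" "progressive_seq t'' \<rho>"
    using u \<rho> by (auto simp: Signals_def Progressive_def)
  then obtain q where "q \<in> Seq" "range q = range t' \<union> range t''"
    using Seq_common_refinement by (metis signal_seq_def progressive_seq_def)
  moreover from this have "orbit_along F q \<rho> \<mu> u = orbit_along F t \<rho> \<mu> u"
    using * by (intro indep) (auto simp: progressive_seq_iff)
  ultimately show "\<exists>t' t'' q. signal_seq t' u \<and> progressive_seq t'' \<rho> \<and> q \<in> Seq \<and>
      range q = range t' \<union> range t'' \<and> orbit_along F t \<rho> \<mu> u = orbit_along F q \<rho> \<mu> u"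
    using * by metis
  show "x = orbit_along F t \<rho> \<mu> u"
    if x: "\<exists>t' t'' q. signal_seq t' u \<and> progressive_seq t'' \<rho> \<and> q \<in> Seq \<and>
      range q = range t' \<union> range t'' \<and> x = orbit_along F q \<rho> \<mu> u" for x
  proof -
    obtain t'' q where q: "progressive_seq t'' \<rho>" "q \<in> Seq" "range t'' \<subseteq> range q"
      "x = orbit_along F q \<rho> \<mu> u"
      using x by blast
    then have "{s. \<rho> s \<noteq> 0} \<subseteq> range q" by (auto simp: progressive_seq_iff)
    then show ?thesis using indep q by simp
  qed
qed

section \<open>Orbits of the serial connection\<close>

lemma orbit_state_serial:
  assumes t: "t \<in> Seq"
  shows "orbit_state (serial_update \<Psi> \<Phi>) t (join_fun \<rho> \<rho>') (join \<mu> \<delta>) u k =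
    join (orbit_state (update \<Phi>) t \<rho> \<mu> u k)
      (orbit_state (update \<Psi>) t \<rho>' \<delta> (orbit_along (update \<Phi>) t \<rho> \<mu> u) k)"
  \<comment> \<open>The second update reads the first component after its own update. This is the
    value of the first orbit at \<open>t k\<close> itself, because pieces are closed on the
    left.\<close>
  by (induction k)
    (simp_all add: serial_update_def serial_map_def join_fun_def orbit_along_at[OF t])

lemma orbit_serial:
  assumes u: "u \<in> Signals" and \<rho>: "\<rho> \<in> Progressive" and \<rho>': "\<rho>' \<in> Progressive"
    and x: "orbit (update \<Phi>) \<rho> \<mu> u \<in> Signals"
  shows "orbit (serial_update \<Psi> \<Phi>) (join_fun \<rho> \<rho>') (join \<mu> \<delta>) u =
    join_fun (orbit (update \<Phi>) \<rho> \<mu> u)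
      (orbit (update \<Psi>) \<rho>' \<delta> (orbit (update \<Phi>) \<rho> \<mu> u))"
proof -
  obtain t where t: "t \<in> Seq" and supp: "{s. \<rho> s \<noteq> 0} \<subseteq> range t" "{s. \<rho>' s \<noteq> 0} \<subseteq> range t"
    "{s. join_fun \<rho> \<rho>' s \<noteq> 0} \<subseteq> range t"
    using Progressive_common_cover[OF \<rho> \<rho>'] .
  let ?x = "orbit_along (update \<Phi>) t \<rho> \<mu> u"
  have first: "orbit (update \<Phi>) \<rho> \<mu> u = ?x"
    using u \<rho> t supp by (intro orbit_eq_orbit_along) auto
  \<comment> \<open>The first orbit is a signal by \<open>x\<close>, so it is a legitimate input,
    and the same \<open>t\<close> covers the support of \<open>\<rho>'\<close>.\<close>
  have second: "orbit (update \<Psi>) \<rho>' \<delta> ?x = orbit_along (update \<Psi>) t \<rho>' \<delta> ?x"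
    using x \<rho>' t supp by (intro orbit_eq_orbit_along) (auto simp: first)
  have "orbit (serial_update \<Psi> \<Phi>) (join_fun \<rho> \<rho>') (join \<mu> \<delta>) u =
      orbit_along (serial_update \<Psi> \<Phi>) t (join_fun \<rho> \<rho>') (join \<mu> \<delta>) u"
    using u t supp by (intro orbit_eq_orbit_along join_fun_Progressive \<rho> \<rho>') auto
  also have "\<dots> = join_fun ?x (orbit_along (update \<Psi>) t \<rho>' \<delta> ?x)"
  proof
    fix s
    show "orbit_along (serial_update \<Psi> \<Phi>) t (join_fun \<rho> \<rho>') (join \<mu> \<delta>) u s =
        join_fun ?x (orbit_along (update \<Psi>) t \<rho>' \<delta> ?x) s"
      using t
    proof (cases rule: Seq_locate[where s = s])
      case 1
      \<comment> \<open>Only the outer \<open>join_fun\<close> is unfolded, here and on the pieces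
        below; \<open>join_fun \<rho> \<rho>'\<close> has to stay intact for
        \<open>orbit_state_serial\<close>.\<close>
      then show ?thesis using t by (simp add: join_fun_def[where x = "orbit_along F t \<rho> \<mu> u" for F \<rho> \<mu> u] orbit_along_before)
    next
      case (2 k)
      then show ?thesis
        by (simp add: join_fun_def[where x = "orbit_along F t \<rho> \<mu> u" for F \<rho> \<mu> u]
            orbit_along_piece[OF t 2] orbit_state_serial[OF t])
    qed
  qed
  finally show ?thesis by (simp only: first second)
qed

section \<open>Initial states and computation functions of the connection\<close>

lemma join_mem_serial_init:
  "join \<mu> \<delta> \<in> serial_init \<Phi> i\<^sub>f \<pi>\<^sub>f i\<^sub>h u \<longleftrightarrow>
     \<mu> \<in> i\<^sub>f u \<and> (\<exists>\<rho>\<in>\<pi>\<^sub>f (\<mu>, u). \<delta> \<in> i\<^sub>h (orbit (update \<Phi>) \<rho> \<mu> u))"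
  by (auto simp: serial_init_def)

lemma join_fun_mem_serial_comp:
  "join_fun \<rho> \<rho>' \<in> serial_comp \<Phi> \<pi>\<^sub>f i\<^sub>h \<pi>\<^sub>h (join \<mu> \<delta>, u) \<longleftrightarrow>
     \<rho> \<in> \<pi>\<^sub>f (\<mu>, u) \<and> \<delta> \<in> i\<^sub>h (orbit (update \<Phi>) \<rho> \<mu> u) \<and>
     \<rho>' \<in> \<pi>\<^sub>h (\<delta>, orbit (update \<Phi>) \<rho> \<mu> u)"
  by (auto simp: serial_comp_def)

lemma serial_Delta_eq_Delta:
  "serial_Delta \<Phi> U i\<^sub>f \<pi>\<^sub>f i\<^sub>h = Delta U (serial_init \<Phi> i\<^sub>f \<pi>\<^sub>f i\<^sub>h)"
  by (auto simp: serial_Delta_def Delta_def serial_init_def)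

lemma join_fun_cases:
  obtains \<rho> \<rho>' where "r = join_fun \<rho> \<rho>'"
proof -
  have "r = join_fun (part1 \<circ> r) (part2 \<circ> r)" by (simp add: join_fun_def)
  then show ?thesis by (rule that)
qed

section \<open>Regularity of the serial connection\<close>

theorem theorem21:
  fixes \<Phi> :: "(bit ^ 'n) \<times> (bit ^ 'm) \<Rightarrow> bit ^ 'n"
    and \<Psi> :: "(bit ^ 'p) \<times> (bit ^ 'n) \<Rightarrow> bit ^ 'p"
    and U :: "(real \<Rightarrow> bit ^ 'm) set"
    and X :: "(real \<Rightarrow> bit ^ 'n) set"
    and f :: "(real \<Rightarrow> bit ^ 'm) \<Rightarrow> (real \<Rightarrow> bit ^ 'n) set"
    and i\<^sub>f :: "(real \<Rightarrow> bit ^ 'm) \<Rightarrow> (bit ^ 'n) set"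
    and \<pi>\<^sub>f :: "(bit ^ 'n) \<times> (real \<Rightarrow> bit ^ 'm) \<Rightarrow> (real \<Rightarrow> bit ^ 'n) set"
    and h :: "(real \<Rightarrow> bit ^ 'n) \<Rightarrow> (real \<Rightarrow> bit ^ 'p) set"
    and i\<^sub>h :: "(real \<Rightarrow> bit ^ 'n) \<Rightarrow> (bit ^ 'p) set"
    and \<pi>\<^sub>h :: "(bit ^ 'p) \<times> (real \<Rightarrow> bit ^ 'n) \<Rightarrow> (real \<Rightarrow> bit ^ 'p) set"
  assumes "regular_system (update \<Phi>) U f i\<^sub>f \<pi>\<^sub>f"
    and "regular_system (update \<Psi>) X h i\<^sub>h \<pi>\<^sub>h"
    and "\<forall>u\<in>U. f u \<subseteq> X"
  shows "(\<forall>u\<in>U. serial h f u =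
        {orbit (serial_update \<Psi> \<Phi>) (join_fun \<rho> \<rho>') (join \<mu> \<delta>) u | \<mu> \<delta> \<rho> \<rho>'.
           join \<mu> \<delta> \<in> serial_init \<Phi> i\<^sub>f \<pi>\<^sub>f i\<^sub>h u \<and>
           join_fun \<rho> \<rho>' \<in> serial_comp \<Phi> \<pi>\<^sub>f i\<^sub>h \<pi>\<^sub>h (join \<mu> \<delta>, u)}) \<and>
      serial_Delta \<Phi> U i\<^sub>f \<pi>\<^sub>f i\<^sub>h = Delta U (serial_init \<Phi> i\<^sub>f \<pi>\<^sub>f i\<^sub>h) \<and>
      regular_system (serial_update \<Psi> \<Phi>) U (serial h f)
        (serial_init \<Phi> i\<^sub>f \<pi>\<^sub>f i\<^sub>h) (serial_comp \<Phi> \<pi>\<^sub>f i\<^sub>h \<pi>\<^sub>h)"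
proof -
  let ?x = "\<lambda>\<rho> \<mu> u. orbit (update \<Phi>) \<rho> \<mu> u"
  let ?i = "serial_init \<Phi> i\<^sub>f \<pi>\<^sub>f i\<^sub>h"
  let ?\<pi> = "serial_comp \<Phi> \<pi>\<^sub>f i\<^sub>h \<pi>\<^sub>h"
  note reg = regular_system_def is_system_def Pstar_def Pi_iff Delta_def
  have U: "U \<noteq> {}" "U \<subseteq> Signals" using assms(1) by (auto simp: reg)
  have f: "f u \<subseteq> Signals" "f u \<noteq> {}" "i\<^sub>f u \<noteq> {}"
    "f u = {?x \<rho> \<mu> u | \<mu> \<rho>. \<mu> \<in> i\<^sub>f u \<and> \<rho> \<in> \<pi>\<^sub>f (\<mu>, u)}" if "u \<in> U" for u
    using assms(1) that unfolding reg by blast+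
  have \<pi>f: "\<pi>\<^sub>f (\<mu>, u) \<subseteq> Progressive" "\<pi>\<^sub>f (\<mu>, u) \<noteq> {}" if "u \<in> U" "\<mu> \<in> i\<^sub>f u" for \<mu> u
    using assms(1) that unfolding reg by blast+
  have h: "h x \<subseteq> Signals" "h x \<noteq> {}" "i\<^sub>h x \<noteq> {}"
    "h x = {orbit (update \<Psi>) \<rho> \<delta> x | \<delta> \<rho>. \<delta> \<in> i\<^sub>h x \<and> \<rho> \<in> \<pi>\<^sub>h (\<delta>, x)}" if "x \<in> X" for x
    using assms(2) that unfolding reg by blast+
  have \<pi>h: "\<pi>\<^sub>h (\<delta>, x) \<subseteq> Progressive" "\<pi>\<^sub>h (\<delta>, x) \<noteq> {}" if "x \<in> X" "\<delta> \<in> i\<^sub>h x" for \<delta> x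
    using assms(2) that unfolding reg by blast+
  \<comment> \<open>The inclusion of \<open>f u\<close> in \<open>X\<close> puts every first orbit
    into the domain of \<open>h\<close>, where \<open>i\<^sub>h\<close> and
    \<open>\<pi>\<^sub>h\<close> are under control.\<close>
  have x: "?x \<rho> \<mu> u \<in> f u" "?x \<rho> \<mu> u \<in> X" "?x \<rho> \<mu> u \<in> Signals"
    if "u \<in> U" "\<mu> \<in> i\<^sub>f u" "\<rho> \<in> \<pi>\<^sub>f (\<mu>, u)" for u \<mu> \<rho>
  proof -
    show "?x \<rho> \<mu> u \<in> f u" using f(4) that by blast
    then show "?x \<rho> \<mu> u \<in> X" "?x \<rho> \<mu> u \<in> Signals" using assms(3) f(1) that by blast+
  qed
  have orbit: "orbit (serial_update \<Psi> \<Phi>) (join_fun \<rho> \<rho>') (join \<mu> \<delta>) u =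
      join_fun (?x \<rho> \<mu> u) (orbit (update \<Psi>) \<rho>' \<delta> (?x \<rho> \<mu> u))"
    if "u \<in> U" "\<mu> \<in> i\<^sub>f u" "\<rho> \<in> \<pi>\<^sub>f (\<mu>, u)" "\<delta> \<in> i\<^sub>h (?x \<rho> \<mu> u)" "\<rho>' \<in> \<pi>\<^sub>h (\<delta>, ?x \<rho> \<mu> u)"
    for u \<mu> \<rho> \<delta> \<rho>'
    using that U x[OF that(1-3)] \<pi>f \<pi>h by (intro orbit_serial) blast+
  have eq: "serial h f u = {orbit (serial_update \<Psi> \<Phi>) (join_fun \<rho> \<rho>') (join \<mu> \<delta>) u | \<mu> \<delta> \<rho> \<rho>'.
      join \<mu> \<delta> \<in> ?i u \<and> join_fun \<rho> \<rho>' \<in> ?\<pi> (join \<mu> \<delta>, u)}" (is "_ = ?R") if u: "u \<in> U" for u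
  proof (intro equalityI subsetI)
    fix z assume "z \<in> serial h f u"
    then obtain x y where z: "z = join_fun x y" "x \<in> f u" "y \<in> h x"
      unfolding serial_def by blast
    then obtain \<mu> \<rho> where x_def: "x = ?x \<rho> \<mu> u" and \<mu>: "\<mu> \<in> i\<^sub>f u" "\<rho> \<in> \<pi>\<^sub>f (\<mu>, u)"
      using f(4)[OF u] by blast
    then obtain \<delta> \<rho>' where y: "y = orbit (update \<Psi>) \<rho>' \<delta> x" "\<delta> \<in> i\<^sub>h x" "\<rho>' \<in> \<pi>\<^sub>h (\<delta>, x)"
      using h(4)[of x] x(2)[OF u] z(3) by blast
    have "z = orbit (serial_update \<Psi> \<Phi>) (join_fun \<rho> \<rho>') (join \<mu> \<delta>) u"
      using orbit u \<mu> y z x_def by simp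
    \<comment> \<open>The \<open>\<rho>\<close> that generates \<open>x\<close> is also the witness
      for the existential in \<open>?i u\<close>.\<close>
    moreover have "join \<mu> \<delta> \<in> ?i u" "join_fun \<rho> \<rho>' \<in> ?\<pi> (join \<mu> \<delta>, u)"
      using \<mu> y x_def by (auto simp: join_mem_serial_init join_fun_mem_serial_comp)
    ultimately show "z \<in> ?R" by blast
  next
    fix z assume "z \<in> ?R"
    then obtain \<mu> \<delta> \<rho> \<rho>' where z: "z = orbit (serial_update \<Psi> \<Phi>) (join_fun \<rho> \<rho>') (join \<mu> \<delta>) u"
      \<comment> \<open>The condition on \<open>\<delta>\<close> must hold for this very
        \<open>\<rho>\<close>. Membership in \<open>?\<pi>\<close> supplies it, whereas the witness
        inside \<open>?i u\<close> may be another function.\<close>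
      and mem: "\<mu> \<in> i\<^sub>f u" "\<rho> \<in> \<pi>\<^sub>f (\<mu>, u)" "\<delta> \<in> i\<^sub>h (?x \<rho> \<mu> u)" "\<rho>' \<in> \<pi>\<^sub>h (\<delta>, ?x \<rho> \<mu> u)"
      unfolding join_mem_serial_init join_fun_mem_serial_comp by blast
    have "orbit (update \<Psi>) \<rho>' \<delta> (?x \<rho> \<mu> u) \<in> h (?x \<rho> \<mu> u)"
      using h(4)[OF x(2)[OF u mem(1,2)]] mem by blast
    then show "z \<in> serial h f u"
      unfolding serial_def z orbit[OF u mem] using x(1)[OF u mem(1,2)] by blast
  qed
  have "serial h f u \<subseteq> Signals \<and> serial h f u \<noteq> {}" if u: "u \<in> U" for u
  proof -
    have X: "x \<in> X" if "x \<in> f u" for x using assms(3) u that by blast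
    obtain x y where "x \<in> f u" "y \<in> h x" using f(2)[OF u] h(2)[OF X] by blast
    then have "join_fun x y \<in> serial h f u" unfolding serial_def by blast
    moreover have "z \<in> Signals" if z: "z \<in> serial h f u" for z
    proof -
      obtain x y where "z = join_fun x y" "x \<in> f u" "y \<in> h x"
        using z unfolding serial_def by blast
      then show ?thesis using f(1)[OF u] h(1)[OF X] by (auto intro: join_fun_Signals)
    qed
    ultimately show ?thesis by blast
  qed
  then have sys: "is_system U (serial h f)" using U by (auto simp: is_system_def Pstar_def)
  have "?i u \<noteq> {}" if u: "u \<in> U" for u
  proof -
    \<comment> \<open>The choices follow the order of dependence: \<open>\<mu>\<close> and
      \<open>\<rho>\<close> determine the orbit, and the orbit determines where
      \<open>\<delta>\<close> is taken from.\<close>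
    obtain \<mu> \<rho> where "\<mu> \<in> i\<^sub>f u" "\<rho> \<in> \<pi>\<^sub>f (\<mu>, u)" using f(3) \<pi>f(2) u by blast
    moreover from this obtain \<delta> where "\<delta> \<in> i\<^sub>h (?x \<rho> \<mu> u)" using h(3) x(2) u by blast
    ultimately have "join \<mu> \<delta> \<in> ?i u" by (auto simp: join_mem_serial_init)
    then show ?thesis by blast
  qed
  then have init: "?i \<in> U \<rightarrow> Pstar UNIV" by (auto simp: Pstar_def)
  have "?\<pi> (join \<mu> \<delta>, u) \<in> Pstar Progressive" if u: "u \<in> U" and w: "join \<mu> \<delta> \<in> ?i u" for u \<mu> \<delta>
  proof -
    \<comment> \<open>The existential in \<open>?i u\<close> is there for this purpose: its witness
      makes \<open>?\<pi>\<close> nonempty at \<open>join \<mu> \<delta>\<close>.\<close>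
    obtain \<rho> where \<rho>: "\<mu> \<in> i\<^sub>f u" "\<rho> \<in> \<pi>\<^sub>f (\<mu>, u)" "\<delta> \<in> i\<^sub>h (?x \<rho> \<mu> u)"
      using w unfolding join_mem_serial_init by blast
    then obtain \<rho>' where "\<rho>' \<in> \<pi>\<^sub>h (\<delta>, ?x \<rho> \<mu> u)" using \<pi>h(2) x(2) u by blast
    then have "join_fun \<rho> \<rho>' \<in> ?\<pi> (join \<mu> \<delta>, u)" using \<rho> by (simp add: join_fun_mem_serial_comp)
    moreover have "r \<in> Progressive" if r: "r \<in> ?\<pi> (join \<mu> \<delta>, u)" for r
    proof -
      obtain \<rho> \<rho>' where "r = join_fun \<rho> \<rho>'" "\<rho> \<in> \<pi>\<^sub>f (\<mu>, u)" "\<delta> \<in> i\<^sub>h (?x \<rho> \<mu> u)"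
        "\<rho>' \<in> \<pi>\<^sub>h (\<delta>, ?x \<rho> \<mu> u)"
        using r by (auto simp: serial_comp_def)
      moreover from this have "\<rho> \<in> Progressive" "\<rho>' \<in> Progressive"
        using \<pi>f(1) \<pi>h(1) x(2) u \<rho>(1) by blast+
      ultimately show ?thesis by (simp add: join_fun_Progressive)
    qed
    ultimately show ?thesis by (auto simp: Pstar_def)
  qed
  then have comp: "?\<pi> \<in> Delta U ?i \<rightarrow> Pstar Progressive"
    unfolding Delta_def Pi_iff by clarsimp (metis join_part1_part2)
  \<comment> \<open>In \<open>eq\<close> the states and computation functions are given as joined
    pairs, in \<open>regular_system\<close> they are arbitrary; joining is surjective in both
    cases.\<close>
  have regular: "serial h f u = {orbit (serial_update \<Psi> \<Phi>) r w u | w r. w \<in> ?i u \<and> r \<in> ?\<pi> (w, u)}"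
    (is "_ = ?R") if u: "u \<in> U" for u
  proof
    show "serial h f u \<subseteq> ?R" unfolding eq[OF u] by blast
    have "orbit (serial_update \<Psi> \<Phi>) r w u \<in> serial h f u"
      if "w \<in> ?i u" "r \<in> ?\<pi> (w, u)" for w r
    proof -
      obtain \<mu> \<delta> where "w = join \<mu> \<delta>" by (metis join_part1_part2)
      moreover obtain \<rho> \<rho>' where "r = join_fun \<rho> \<rho>'" by (rule join_fun_cases)
      ultimately show ?thesis using that unfolding eq[OF u] by blast
    qed
    then show "?R \<subseteq> serial h f u" by blast
  qed
  show ?thesis
    unfolding regular_system_def
    by (intro conjI ballI) (fact eq serial_Delta_eq_Delta sys init comp regular)+
qed

end
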